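(* Let $P=(x_i)_{i=1}^\infty$ be a sequence of points in $[0,1)$, let $n\in\mathbb{N}$, and let $f:[0,1)\to[0,1)$ be an arbitrary interval exchange transformation with $n$ intervals. Denote by $P^*$ the sequence $(f(x_i))_{i=1}^\infty$. Then for every $N\in\mathbb{N}$, $$\frac{1}{n}\,D_N^*(P)\;\le\; D_N^*(P^* )\;\le\; n\,D_N^*(P).$$
   Context: $\mathbb{N}=\{1,2,3,\ldots\}$. An interval exchange transformation with $n$ intervals ($n$-IET) is a bijection $f:[0,1)\to[0,1)$ for which there is a partition of $[0,1)$ into $n$ half-open subintervals $I_1,\dots,I_n$ (closed on the left, open on the right) of lengths $\lambda_1,\dots,\lambda_n>0$ with $\sum_i\lambda_i=1$, such that $f$ is a translation on each $I_i$; that is, $f$ cuts $[0,1)$ into these subintervals and rearranges them according to a permutation. For a sequence $P=(x_i)_{i=1}^\infty$ in $[0,1)$, the star-discrepancy of its first $N$ points is $$D_N^*(P)=\sup_{B=[0,a)\subset[0,1)}\left|\frac{|\{1\le i\le N : x_i\in B\}|}{N}-\lambda(B)\right|,$$ where the supremum is over all intervals $[0,a)\subset[0,1)$ anchored at zero, points are counted with multiplicity, and $\lambda$ is Lebesgue measure. *)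

theory Defs
  imports "HOL-Analysis.Analysis"
begin

(* Sequences are indexed from 1: the value of x at 0 is never used.
   The index a = 1 is included, since [0,1) is itself an admissible test interval.
   For a sequence in [0,1) and N > 0, the values under the supremum lie in [0,1],
   so the (conditionally complete) real supremum is the genuine one. *)
definition star_discrepancy :: "(nat \<Rightarrow> real) \<Rightarrow> nat \<Rightarrow> real" where
  "star_discrepancy x N =
     (SUP a\<in>{0..1}. \<bar>real (card {i \<in> {1..N}. x i \<in> {0..<a}}) / real N
                       - measure lborel {0..<a}\<bar>)"

(* The i-th interval is [l i, l i + len i), and f is translation by t i on it. The labelling of the
   intervals is arbitrary, not necessarily from left to right; f outside [0,1) is irrelevant. *)
definition interval_exchange :: "nat \<Rightarrow> (real \<Rightarrow> real) \<Rightarrow> bool" where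
  "interval_exchange n f \<longleftrightarrow>
     bij_betw f {0..<1} {0..<1} \<and>
     (\<exists>l len t :: nat \<Rightarrow> real.
        (\<forall>i\<in>{1..n}. len i > 0) \<and>
        (\<Sum>i=1..n. len i) = 1 \<and>
        disjoint_family_on (\<lambda>i. {l i..<l i + len i}) {1..n} \<and>
        (\<Union>i\<in>{1..n}. {l i..<l i + len i}) = {0..<1} \<and>
        (\<forall>i\<in>{1..n}. \<forall>y\<in>{l i..<l i + len i}. f y = y + t i))"

end

theory Submission
  imports Defs
begin

text \<open>
  Write \<open>\<Delta>(S)\<close> for the signed discrepancy of a set \<open>S\<close> (share of points in \<open>S\<close> minus its length) and
  \<open>F(y) = \<Delta>([0,y))\<close>. Since \<open>f\<close> is an injective piecewise translation, the signed discrepancy of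
  \<open>[0,a)\<close> for the transformed points equals \<open>\<Delta>(f\<^sup>-\<^sup>1[0,a))\<close> for the original points. For
  \<open>a = 1\<close> it vanishes; otherwise let \<open>a = f(y)\<close> with \<open>y\<close> in the exchanged
  interval \<open>I\<^sub>j\<close>. Then \<open>f\<^sup>-\<^sup>1[0,a)\<close> consists of some complete intervals
  \<open>I\<^sub>i\<close>, whose indices form a set \<open>J\<close>, and of the part of \<open>I\<^sub>j\<close> to the left of \<open>y\<close>; its discrepancy is
  a signed sum of values of \<open>F\<close> at endpoints.

  Bounding the pieces one at a time would give only the factor \<open>2n\<close>. But an endpoint shared by two
  neighbouring complete pieces cancels, and \<open>F\<close> vanishes at 0 and 1. So each of the \<open>n - 1\<close> inner
  cut points of the partition is counted with a coefficient in \<open>{-1,0,1}\<close>, and the extra cut \<open>y\<close>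
  once: in total at most \<open>n\<close> values of \<open>F\<close>, each at most the star-discrepancy in absolute
  value (lemmas \<open>abs_endpoint_sums_le\<close> and \<open>star_discrepancy_image_le\<close>).

  The lower bound is the upper bound for the inverse of \<open>f\<close>, which is again an interval exchange with
  \<open>n\<close> intervals.
\<close>

section \<open>Signed discrepancy as a finitely additive set function\<close>

definition signed_discrepancy :: "(nat \<Rightarrow> real) \<Rightarrow> nat \<Rightarrow> real set \<Rightarrow> real" where
  "signed_discrepancy x N S = real (card {i \<in> {1..N}. x i \<in> S}) / real N - measure lborel S"

lemma star_discrepancy_eq_SUP:
  "star_discrepancy x N = (SUP a\<in>{0..1}. \<bar>signed_discrepancy x N {0..<a}\<bar>)"
  by (simp add: star_discrepancy_def signed_discrepancy_def)

lemma star_discrepancy_cong: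
  assumes "\<And>i. i \<in> {1..N} \<Longrightarrow> x i = y i"
  shows "star_discrepancy x N = star_discrepancy y N"
proof -
  have "{i \<in> {1..N}. x i \<in> S} = {i \<in> {1..N}. y i \<in> S}" for S
    using assms by auto
  then show ?thesis
    by (simp only: star_discrepancy_def)
qed

lemma abs_signed_discrepancy_le:
  assumes "a \<in> {0..1}"
  shows "\<bar>signed_discrepancy x N {0..<a}\<bar> \<le> star_discrepancy x N"
  unfolding star_discrepancy_eq_SUP
proof (rule cSUP_upper[OF assms])
  have "\<bar>signed_discrepancy x N {0..<b}\<bar> \<le> 1" if "b \<in> {0..1}" for b
  proof -
    have "card {i \<in> {1..N}. x i \<in> {0..<b}} \<le> card {1..N}"
      by (rule card_mono) auto
    then have "real (card {i \<in> {1..N}. x i \<in> {0..<b}}) / real N \<le> 1"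
      by (auto simp: divide_le_eq_1)
    moreover have "0 \<le> real (card {i \<in> {1..N}. x i \<in> {0..<b}}) / real N"
      by simp
    moreover have "measure lborel {0..<b} = b" "0 \<le> b" "b \<le> 1"
      using that by simp_all
    ultimately show ?thesis
      unfolding signed_discrepancy_def by linarith
  qed
  then show "bdd_above ((\<lambda>a. \<bar>signed_discrepancy x N {0..<a}\<bar>) ` {0..1})"
    by (intro bdd_aboveI2)
qed

lemma star_discrepancy_nonneg: "0 \<le> star_discrepancy x N"
  using abs_signed_discrepancy_le[of 0 x N] by simp

lemma signed_discrepancy_empty [simp]: "signed_discrepancy x N {} = 0"
  by (simp add: signed_discrepancy_def)

lemma signed_discrepancy_unit:
  assumes "\<And>i. i \<in> {1..N} \<Longrightarrow> x i \<in> {0..<1}" "N \<ge> 1"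
  shows "signed_discrepancy x N {0..<1} = 0"
proof -
  have "{i \<in> {1..N}. x i \<in> {0..<1}} = {1..N}"
    using assms(1) by blast
  then show ?thesis
    using assms(2) unfolding signed_discrepancy_def by simp
qed

lemma signed_discrepancy_UN:
  assumes "finite A" "disjoint_family_on S A"
    and "\<And>k. k \<in> A \<Longrightarrow> S k \<in> sets lborel" "\<And>k. k \<in> A \<Longrightarrow> emeasure lborel (S k) \<noteq> \<infinity>"
  shows "signed_discrepancy x N (\<Union>k\<in>A. S k) = (\<Sum>k\<in>A. signed_discrepancy x N (S k))"
proof -
  have "{i \<in> {1..N}. x i \<in> (\<Union>k\<in>A. S k)} = (\<Union>k\<in>A. {i \<in> {1..N}. x i \<in> S k})"
    by auto
  moreover have "card \<dots> = (\<Sum>k\<in>A. card {i \<in> {1..N}. x i \<in> S k})"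
    using assms(1,2) by (intro card_UN_disjoint) (auto simp: disjoint_family_on_def)
  moreover have "measure lborel (\<Union>k\<in>A. S k) = (\<Sum>k\<in>A. measure lborel (S k))"
    using assms by (intro measure_finite_Union) auto
  ultimately show ?thesis
    by (simp add: signed_discrepancy_def sum_subtractf sum_divide_distrib)
qed

lemma signed_discrepancy_ivl:
  assumes "0 \<le> c" "c \<le> d"
  shows "signed_discrepancy x N {c..<d} =
         signed_discrepancy x N {0..<d} - signed_discrepancy x N {0..<c}"
proof -
  have eq: "{0..<d} = (\<Union>b\<in>{True, False}. if b then {0..<c} else {c..<d})"
    using assms by auto
  have "signed_discrepancy x N {0..<d} =
        (\<Sum>b\<in>{True, False}. signed_discrepancy x N (if b then {0..<c} else {c..<d}))"
    unfolding eq using assms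
    by (intro signed_discrepancy_UN) (auto simp: disjoint_family_on_def)
  then show ?thesis
    by simp
qed

section \<open>Endpoints of a partition of the unit interval\<close>

locale unit_partition =
  fixes n :: nat and l r :: "nat \<Rightarrow> real"
  assumes less: "i \<in> {1..n} \<Longrightarrow> l i < r i"
    and disjoint: "disjoint_family_on (\<lambda>i. {l i..<r i}) {1..n}"
    and cover: "(\<Union>i\<in>{1..n}. {l i..<r i}) = {0..<1}"
begin

lemma index_unique:
  assumes "i \<in> {1..n}" "k \<in> {1..n}" "y \<in> {l i..<r i}" "y \<in> {l k..<r k}"
  shows "i = k"
  using disjoint assms unfolding disjoint_family_on_def by blast

lemma index_exists:
  assumes "y \<in> {0..<1}"
  obtains i where "i \<in> {1..n}" "y \<in> {l i..<r i}"
  using assms cover by blast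

lemma subset_unit: "i \<in> {1..n} \<Longrightarrow> {l i..<r i} \<subseteq> {0..<1}"
  using cover by blast

lemma bounds:
  assumes "i \<in> {1..n}"
  shows "0 \<le> l i" "l i < 1" "r i \<le> 1"
  using subset_unit[OF assms] less[OF assms] by auto

lemma inj_on_left: "inj_on l {1..n}"
proof (rule inj_onI)
  fix i k assume "i \<in> {1..n}" "k \<in> {1..n}" "l i = l k"
  then show "i = k"
    using index_unique[of i k "l i"] less[of i] less[of k] by simp
qed

lemma inj_on_right: "inj_on r {1..n}"
proof (rule inj_onI)
  fix i k assume "i \<in> {1..n}" "k \<in> {1..n}" "r i = r k"
  then show "i = k"
    using index_unique[of i k "max (l i) (l k)"] less[of i] less[of k] by simp
qed

lemma zero_left_endpoint: "0 \<in> l ` {1..n}"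
proof -
  obtain i where i: "i \<in> {1..n}" "0 \<in> {l i..<r i}"
    using index_exists[of 0] by auto
  then have "l i = 0"
    using bounds(1)[OF i(1)] by simp
  then show ?thesis
    using i(1) by force
qed

text \<open>Apart from 0 and 1, every endpoint is shared by two neighbours: the interval that contains
  \<open>r i\<close> has to start there, as it would meet the \<open>i\<close>-th one otherwise.\<close>

lemma right_endpoint:
  assumes "i \<in> {1..n}" "r i \<noteq> 1"
  shows "r i \<in> l ` {1..n} - {0}"
proof -
  have "r i \<in> {0..<1}"
    using bounds[OF assms(1)] less[OF assms(1)] assms(2) by simp
  then obtain k where k: "k \<in> {1..n}" "r i \<in> {l k..<r k}"
    by (rule index_exists)
  have "\<not> l k < r i"
  proof
    assume "l k < r i"
    then have "i = k"
      using index_unique[OF assms(1) k(1), of "max (l i) (l k)"] less[OF assms(1)] less[OF k(1)] k(2)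
      by simp
    with k(2) show False
      by simp
  qed
  then have "r i = l k"
    using k(2) by simp
  then show ?thesis
    using k(1) bounds(1)[OF assms(1)] less[OF assms(1)] by auto
qed

text \<open>The cancellation behind the factor \<open>n\<close>: both sums run over distinct points, so when they are
  rewritten as sums over the \<open>n - 1\<close> inner cut points, each of these gets coefficient -1, 0 or 1.\<close>

lemma abs_endpoint_sums_le:
  fixes F :: "real \<Rightarrow> real"
  assumes "F 0 = 0" "F 1 = 0" and F_le: "\<And>p. p \<in> {0..1} \<Longrightarrow> \<bar>F p\<bar> \<le> D"
    and J: "J \<subseteq> {1..n}" and K: "K \<subseteq> {1..n}"
  shows "\<bar>(\<Sum>i\<in>J. F (r i)) - (\<Sum>i\<in>K. F (l i))\<bar> \<le> real (n - 1) * D"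
proof -
  define C where "C = l ` {1..n} - {0}"
  have [simp]: "finite C"
    by (simp add: C_def)
  have fin: "finite J" "finite K"
    using J K finite_subset by blast+
  have "card C = n - 1"
    using zero_left_endpoint inj_on_left by (simp add: C_def card_image)
  have "(\<Sum>i\<in>J. F (r i)) = (\<Sum>p\<in>r ` J. F p)"
    using inj_on_subset[OF inj_on_right J] by (simp add: sum.reindex)
  also have "\<dots> = (\<Sum>p\<in>C \<inter> r ` J. F p)"
  proof (intro sum.mono_neutral_right ballI)
    fix p assume "p \<in> r ` J - C \<inter> r ` J"
    then have "p = 1"
      using J right_endpoint unfolding C_def by blast
    then show "F p = 0"
      using assms(2) by simp
  qed (use fin(1) in auto)
  also have "\<dots> = (\<Sum>p\<in>C. if p \<in> r ` J then F p else 0)"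
    by (simp add: sum.inter_restrict)
  finally have right: "(\<Sum>i\<in>J. F (r i)) = (\<Sum>p\<in>C. if p \<in> r ` J then F p else 0)" .
  have "(\<Sum>i\<in>K. F (l i)) = (\<Sum>p\<in>l ` K. F p)"
    using inj_on_subset[OF inj_on_left K] by (simp add: sum.reindex)
  also have "\<dots> = (\<Sum>p\<in>C \<inter> l ` K. F p)"
    using fin(2) K assms(1) by (intro sum.mono_neutral_right) (auto simp: C_def)
  also have "\<dots> = (\<Sum>p\<in>C. if p \<in> l ` K then F p else 0)"
    by (simp add: sum.inter_restrict)
  finally have left: "(\<Sum>i\<in>K. F (l i)) = (\<Sum>p\<in>C. if p \<in> l ` K then F p else 0)" .
  have "\<bar>(\<Sum>i\<in>J. F (r i)) - (\<Sum>i\<in>K. F (l i))\<bar> =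
        \<bar>\<Sum>p\<in>C. (if p \<in> r ` J then F p else 0) - (if p \<in> l ` K then F p else 0)\<bar>"
    unfolding right left by (simp add: sum_subtractf)
  also have "\<dots> \<le> (\<Sum>p\<in>C. D)"
  proof (rule order_trans[OF sum_abs], rule sum_mono)
    fix p assume "p \<in> C"
    then have "p \<in> {0..1}"
      using bounds by (auto simp: C_def less_imp_le)
    then show "\<bar>(if p \<in> r ` J then F p else 0) - (if p \<in> l ` K then F p else 0)\<bar> \<le> D"
      using F_le[of p] by auto
  qed
  finally show ?thesis
    using \<open>card C = n - 1\<close> by simp
qed

end

section \<open>Interval exchanges\<close>

locale interval_exchange_data = unit_partition +
  fixes f :: "real \<Rightarrow> real" and t :: "nat \<Rightarrow> real"
  assumes bij: "bij_betw f {0..<1} {0..<1}"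
    and translation: "i \<in> {1..n} \<Longrightarrow> y \<in> {l i..<r i} \<Longrightarrow> f y = y + t i"
begin

lemma translated_mem_iff:
  assumes i: "i \<in> {1..n}" and sub: "l i \<le> c" "d \<le> r i" and "y \<in> {0..<1}"
  shows "f y \<in> {c + t i..<d + t i} \<longleftrightarrow> y \<in> {c..<d}"
proof
  assume fy: "f y \<in> {c + t i..<d + t i}"
  define z where "z = f y - t i"
  have z: "z \<in> {c..<d}"
    using fy by (auto simp: z_def)
  then have "z \<in> {l i..<r i}"
    using sub by auto
  then have "f z = f y" "z \<in> {0..<1}"
    using translation[OF i] subset_unit[OF i] by (auto simp: z_def)
  then have "z = y"
    using bij assms(4) by (metis bij_betw_imp_inj_on inj_onD)
  with z show "y \<in> {c..<d}"
    by simp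
next
  assume "y \<in> {c..<d}"
  then show "f y \<in> {c + t i..<d + t i}"
    using translation[OF i, of y] sub by simp
qed

lemma image_eq:
  assumes "i \<in> {1..n}"
  shows "f ` {l i..<r i} = {l i + t i..<r i + t i}"
proof -
  have "f ` {l i..<r i} = (+) (t i) ` {l i..<r i}"
    using translation[OF assms] by (intro image_cong) (auto simp: add.commute)
  then show ?thesis
    by (simp only: image_add_atLeastLessThan add.commute[of "t i"])
qed

lemma image_partition: "unit_partition n (\<lambda>i. l i + t i) (\<lambda>i. r i + t i)"
proof
  fix i assume "i \<in> {1..n}"
  then show "l i + t i < r i + t i"
    using less by simp
next
  have inj: "inj_on f {0..<1}" and onto: "f ` {0..<1} = {0..<1}"
    using bij by (auto simp: bij_betw_def)
  show "disjoint_family_on (\<lambda>i. {l i + t i..<r i + t i}) {1..n}"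
    unfolding disjoint_family_on_def
  proof (intro ballI impI)
    fix i k assume ik: "i \<in> {1..n}" "k \<in> {1..n}" "i \<noteq> k"
    have "f ` {l i..<r i} \<inter> f ` {l k..<r k} = f ` ({l i..<r i} \<inter> {l k..<r k})"
      using inj_on_image_Int[OF inj subset_unit[OF ik(1)] subset_unit[OF ik(2)]] by simp
    also have "{l i..<r i} \<inter> {l k..<r k} = {}"
      using disjoint ik by (auto simp: disjoint_family_on_def)
    finally show "{l i + t i..<r i + t i} \<inter> {l k + t k..<r k + t k} = {}"
      using ik by (simp add: image_eq)
  qed
  have "(\<Union>i\<in>{1..n}. {l i + t i..<r i + t i}) = (\<Union>i\<in>{1..n}. f ` {l i..<r i})"
    by (intro SUP_cong) (simp_all add: image_eq)
  also have "\<dots> = f ` {0..<1}"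
    using cover by (metis image_UN)
  finally show "(\<Union>i\<in>{1..n}. {l i + t i..<r i + t i}) = {0..<1}"
    using onto by simp
qed

lemma inverse_data:
  "interval_exchange_data n (\<lambda>i. l i + t i) (\<lambda>i. r i + t i) (inv_into {0..<1} f) (\<lambda>i. - t i)"
proof (intro interval_exchange_data.intro image_partition interval_exchange_data_axioms.intro)
  show "bij_betw (inv_into {0..<1} f) {0..<1} {0..<1}"
    using bij by (rule bij_betw_inv_into)
next
  fix i y assume i: "i \<in> {1..n}" and y: "y \<in> {l i + t i..<r i + t i}"
  then have "y - t i \<in> {l i..<r i}"
    by auto
  then have "y - t i \<in> {0..<1}" "f (y - t i) = y"
    using translation[OF i] subset_unit[OF i] by auto
  then show "inv_into {0..<1} f y = y + - t i"
    using bij by (metis bij_betw_imp_inj_on inv_into_f_f diff_conv_add_uminus)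
qed

text \<open>A translated piece keeps its length, and since \<open>f\<close> is injective no point from outside the piece
  can land in its image.\<close>

lemma signed_discrepancy_translate:
  assumes "i \<in> {1..n}" "l i \<le> c" "c \<le> d" "d \<le> r i"
    and x: "\<And>i. i \<in> {1..N} \<Longrightarrow> x i \<in> {0..<1}"
  shows "signed_discrepancy (\<lambda>i. f (x i)) N {c + t i..<d + t i} = signed_discrepancy x N {c..<d}"
proof -
  have "{k \<in> {1..N}. f (x k) \<in> {c + t i..<d + t i}} = {k \<in> {1..N}. x k \<in> {c..<d}}"
    using translated_mem_iff[OF assms(1,2,4)] x by blast
  then show ?thesis
    using assms(3) unfolding signed_discrepancy_def by simp
qed

lemma star_discrepancy_image_le:
  assumes x: "\<And>i. i \<in> {1..N} \<Longrightarrow> x i \<in> {0..<1}" and N: "N \<ge> 1"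
  shows "star_discrepancy (\<lambda>i. f (x i)) N \<le> real n * star_discrepancy x N"
  unfolding star_discrepancy_eq_SUP[of "\<lambda>i. f (x i)"]
proof (rule cSUP_least)
  let ?D = "star_discrepancy x N"
  let ?G = "signed_discrepancy (\<lambda>i. f (x i)) N"
  define F where "F p = signed_discrepancy x N {0..<p}" for p
  interpret im: unit_partition n "\<lambda>i. l i + t i" "\<lambda>i. r i + t i"
    by (rule image_partition)
  have F0: "F 0 = 0"
    by (simp add: F_def)
  have F1: "F 1 = 0"
    unfolding F_def by (rule signed_discrepancy_unit[OF x N])
  have F_le: "\<bar>F p\<bar> \<le> ?D" if "p \<in> {0..1}" for p
    unfolding F_def by (rule abs_signed_discrepancy_le[OF that])
  fix a :: real assume a: "a \<in> {0..1}"
  show "\<bar>?G {0..<a}\<bar> \<le> real n * ?D"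
  proof (cases "a = 1")
    case True
    have "f (x i) \<in> {0..<1}" if "i \<in> {1..N}" for i
      using bij x[OF that] by (rule bij_betw_apply)
    then have "?G {0..<a} = 0"
      unfolding True by (rule signed_discrepancy_unit[OF _ N])
    then show ?thesis
      using star_discrepancy_nonneg[of x N] by simp
  next
    case False
    with a have "a \<in> {0..<1}"
      by simp
    then obtain j where j: "j \<in> {1..n}" and aj: "a \<in> {l j + t j..<r j + t j}"
      by (rule im.index_exists)
    define y where "y = a - t j"
    have y: "l j \<le> y" "y < r j" "y + t j = a"
      using aj by (auto simp: y_def)
    define J where "J = {i \<in> {1..n}. r i + t i \<le> a}"
    have J: "J \<subseteq> {1..n}" "finite J" "j \<notin> J"
      using aj by (auto simp: J_def)
    \<comment> \<open>Right ends of the pieces of the preimage of \<open>{0..<a}\<close>.\<close>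
    define e where "e i = (if i = j then y else r i)" for i
    have e: "l i \<le> e i" "e i \<le> r i" if "i \<in> insert j J" for i
      using that y less[of i] J(1) by (auto simp: e_def)
    have pieces: "{0..<a} = (\<Union>i\<in>insert j J. {l i + t i..<e i + t i})"
    proof (intro equalityI subsetI)
      fix z assume z: "z \<in> {0..<a}"
      then have "z \<in> {0..<1}"
        using a by simp
      then obtain i where i: "i \<in> {1..n}" "z \<in> {l i + t i..<r i + t i}"
        by (rule im.index_exists)
      show "z \<in> (\<Union>i\<in>insert j J. {l i + t i..<e i + t i})"
      proof (cases "i = j")
        case True
        then show ?thesis
          using i(2) z y by (auto simp: e_def)
      next
        case False
        \<comment> \<open>The image interval meets \<open>{0..<a}\<close> but does not contain \<open>a\<close>, so it ends before \<open>a\<close>.\<close>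
        have "\<not> a < r i + t i"
        proof
          assume "a < r i + t i"
          then have "a \<in> {l i + t i..<r i + t i}"
            using i(2) z by simp
          then show False
            using im.index_unique[OF i(1) j _ aj] False by simp
        qed
        then have "i \<in> J"
          using i(1) by (simp add: J_def)
        then show ?thesis
          using i(2) False by (auto simp: e_def)
      qed
    next
      fix z assume "z \<in> (\<Union>i\<in>insert j J. {l i + t i..<e i + t i})"
      then obtain i where i: "i \<in> insert j J" and z: "z \<in> {l i + t i..<e i + t i}"
        by blast
      have "i \<in> {1..n}"
        using i j J(1) by blast
      then have "0 \<le> l i + t i"
        by (rule im.bounds(1))
      moreover have "e i + t i \<le> a"
        using i y by (auto simp: e_def J_def)
      ultimately show "z \<in> {0..<a}"
        using z by simp
    qed
    have "?G {0..<a} = (\<Sum>i\<in>insert j J. ?G {l i + t i..<e i + t i})"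
      unfolding pieces
    proof (rule signed_discrepancy_UN)
      have "disjoint_family_on (\<lambda>i. {l i + t i..<r i + t i}) (insert j J)"
        using im.disjoint j J(1) by (elim disjoint_family_on_mono[rotated]) auto
      then show "disjoint_family_on (\<lambda>i. {l i + t i..<e i + t i}) (insert j J)"
        by (rule disjoint_family_on_bisimulation)
           (use e in \<open>fastforce simp: disjoint_iff\<close>)
    next
      fix i assume "i \<in> insert j J"
      then show "emeasure lborel {l i + t i..<e i + t i} \<noteq> \<infinity>"
        using e(1)[of i] by simp
    qed (use J in auto)
    also have "\<dots> = (\<Sum>i\<in>insert j J. F (e i) - F (l i))"
    proof (rule sum.cong[OF refl])
      fix i assume i: "i \<in> insert j J"
      then have i': "i \<in> {1..n}"
        using j J(1) by blast
      have "?G {l i + t i..<e i + t i} = signed_discrepancy x N {l i..<e i}"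
        using i' e[OF i] x by (intro signed_discrepancy_translate) auto
      also have "\<dots> = F (e i) - F (l i)"
        unfolding F_def using bounds(1)[OF i'] e(1)[OF i] by (rule signed_discrepancy_ivl)
      finally show "?G {l i + t i..<e i + t i} = F (e i) - F (l i)" .
    qed
    also have "\<dots> = F y + ((\<Sum>i\<in>J. F (r i)) - (\<Sum>i\<in>insert j J. F (l i)))"
    proof -
      have "(\<Sum>i\<in>J. F (e i)) = (\<Sum>i\<in>J. F (r i))"
        using J(3) by (intro sum.cong) (auto simp: e_def)
      then have "(\<Sum>i\<in>insert j J. F (e i)) = F y + (\<Sum>i\<in>J. F (r i))"
        using J by (simp add: e_def)
      then show ?thesis
        by (simp add: sum_subtractf)
    qed
    finally have "\<bar>?G {0..<a}\<bar> \<le> \<bar>F y\<bar> + \<bar>(\<Sum>i\<in>J. F (r i)) - (\<Sum>i\<in>insert j J. F (l i))\<bar>"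
      by simp
    also have "\<dots> \<le> ?D + real (n - 1) * ?D"
    proof (rule add_mono)
      show "\<bar>F y\<bar> \<le> ?D"
        using F_le[of y] y bounds[OF j] by simp
      show "\<bar>(\<Sum>i\<in>J. F (r i)) - (\<Sum>i\<in>insert j J. F (l i))\<bar> \<le> real (n - 1) * ?D"
        using F0 F1 F_le J(1) j by (intro abs_endpoint_sums_le) auto
    qed
    also have "\<dots> = real n * ?D"
      using j by (simp add: of_nat_diff algebra_simps)
    finally show ?thesis .
  qed
qed simp

end

lemma interval_exchangeE:
  assumes "interval_exchange n f"
  obtains l r t where "interval_exchange_data n l r f t"
proof -
  obtain l len t where bij: "bij_betw f {0..<1} {0..<1}"
    and len: "\<forall>i\<in>{1..n}. len i > 0"
    and part: "disjoint_family_on (\<lambda>i. {l i..<l i + len i}) {1..n}"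
      "(\<Union>i\<in>{1..n}. {l i..<l i + len i}) = {0..<1}"
    and trans: "\<forall>i\<in>{1..n}. \<forall>y\<in>{l i..<l i + len i}. f y = y + t i"
    using assms unfolding interval_exchange_def by (elim conjE exE) (rule that)
  have "interval_exchange_data n l (\<lambda>i. l i + len i) f t"
    using bij len part trans by unfold_locales auto
  then show thesis
    by (rule that)
qed

theorem theorem1p3:
  fixes x :: "nat \<Rightarrow> real" and f :: "real \<Rightarrow> real" and n N :: nat
  assumes "\<And>i. i \<ge> 1 \<Longrightarrow> x i \<in> {0..<1}"
    and "n \<ge> 1"
    and "interval_exchange n f"
    and "N \<ge> 1"
  shows "(1 / real n) * star_discrepancy x N \<le> star_discrepancy (\<lambda>i. f (x i)) N \<and>
         star_discrepancy (\<lambda>i. f (x i)) N \<le> real n * star_discrepancy x N"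
proof -
  obtain l r t where "interval_exchange_data n l r f t"
    using assms(3) by (rule interval_exchangeE)
  then interpret interval_exchange_data n l r f t .
  interpret inverse: interval_exchange_data n "\<lambda>i. l i + t i" "\<lambda>i. r i + t i"
    "inv_into {0..<1} f" "\<lambda>i. - t i"
    by (rule inverse_data)
  have x: "x i \<in> {0..<1}" if "i \<in> {1..N}" for i
    using that assms(1) by simp
  have fx: "f (x i) \<in> {0..<1}" if "i \<in> {1..N}" for i
    using bij x[OF that] by (rule bij_betw_apply)
  have "inv_into {0..<1} f (f (x i)) = x i" if "i \<in> {1..N}" for i
    using bij_betw_imp_inj_on[OF bij] x[OF that] by (rule inv_into_f_f)
  then have "star_discrepancy x N = star_discrepancy (\<lambda>i. inv_into {0..<1} f (f (x i))) N"
    by (intro star_discrepancy_cong) simp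
  also have "\<dots> \<le> real n * star_discrepancy (\<lambda>i. f (x i)) N"
    by (rule inverse.star_discrepancy_image_le[OF fx assms(4)])
  finally have "(1 / real n) * star_discrepancy x N \<le> star_discrepancy (\<lambda>i. f (x i)) N"
    using assms(2) by (simp add: field_simps)
  then show ?thesis
    using star_discrepancy_image_le[of N x, OF x assms(4)] by blast
qed

end
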